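(* Let $(A,\rightarrow,\rightsquigarrow,1)$ be a pseudo BCK-algebra. The following are equivalent: (a) $A$ is commutative; (b) for all $x,y\in A$: $x\rightarrow y=((y\rightarrow x)\rightsquigarrow x)\rightarrow y$ and $x\rightsquigarrow y=((y\rightsquigarrow x)\rightarrow x)\rightsquigarrow y$; (c) for all $x,y\in A$: $(x\rightarrow y)\rightsquigarrow y=(((x\rightarrow y)\rightsquigarrow y)\rightarrow x)\rightsquigarrow x$ and $(x\rightsquigarrow y)\rightarrow y=(((x\rightsquigarrow y)\rightarrow y)\rightsquigarrow x)\rightarrow x$; (d) for all $x,y\in A$, $x\le y$ implies $y=(y\rightarrow x)\rightsquigarrow x=(y\rightsquigarrow x)\rightarrow x$.
   Context: A pseudo BCK-algebra is an algebra $(A,\rightarrow,\rightsquigarrow,1)$ of type $(2,2,0)$ such that for all $x,y,z\in A$: $(x\rightarrow y)\rightsquigarrow[(y\rightarrow z)\rightsquigarrow(x\rightarrow z)]=1$; $(x\rightsquigarrow y)\rightarrow[(y\rightsquigarrow z)\rightarrow(x\rightsquigarrow z)]=1$; $1\rightarrow x=x$; $1\rightsquigarrow x=x$; $x\rightarrow 1=1$; and if $x\rightarrow y=1$ and $y\rightarrow x=1$ then $x=y$. The partial order is $x\le y$ iff $x\rightarrow y=1$ (equivalently iff $x\rightsquigarrow y=1$). $A$ is commutative if $(x\rightarrow y)\rightsquigarrow y=(y\rightarrow x)\rightsquigarrow x$ and $(x\rightsquigarrow y)\rightarrow y=(y\rightsquigarrow x)\rightarrow x$ for all $x,y\in A$.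 *)

theory Defs
  imports Main
begin

locale pseudo_bck_algebra =
  fixes A :: "'a set"
    and imp :: "'a \<Rightarrow> 'a \<Rightarrow> 'a" (infixr "\<rightarrow>" 70)
    and wimp :: "'a \<Rightarrow> 'a \<Rightarrow> 'a" (infixr "\<leadsto>" 70)
    and one :: 'a ("\<one>")
  assumes imp_closed: "\<lbrakk>x \<in> A; y \<in> A\<rbrakk> \<Longrightarrow> x \<rightarrow> y \<in> A"
    and wimp_closed: "\<lbrakk>x \<in> A; y \<in> A\<rbrakk> \<Longrightarrow> x \<leadsto> y \<in> A"
    and one_closed: "\<one> \<in> A"
    and imp_trans: "\<lbrakk>x \<in> A; y \<in> A; z \<in> A\<rbrakk> \<Longrightarrow> (x \<rightarrow> y) \<leadsto> ((y \<rightarrow> z) \<leadsto> (x \<rightarrow> z)) = \<one>"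
    and wimp_trans: "\<lbrakk>x \<in> A; y \<in> A; z \<in> A\<rbrakk> \<Longrightarrow> (x \<leadsto> y) \<rightarrow> ((y \<leadsto> z) \<rightarrow> (x \<leadsto> z)) = \<one>"
    and one_imp: "x \<in> A \<Longrightarrow> \<one> \<rightarrow> x = x"
    and one_wimp: "x \<in> A \<Longrightarrow> \<one> \<leadsto> x = x"
    and imp_one: "x \<in> A \<Longrightarrow> x \<rightarrow> \<one> = \<one>"
    and imp_antisym: "\<lbrakk>x \<in> A; y \<in> A; x \<rightarrow> y = \<one>; y \<rightarrow> x = \<one>\<rbrakk> \<Longrightarrow> x = y"

definition pbck_le :: "('a \<Rightarrow> 'a \<Rightarrow> 'a) \<Rightarrow> 'a \<Rightarrow> 'a \<Rightarrow> 'a \<Rightarrow> bool"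
  where "pbck_le imp one x y \<longleftrightarrow> imp x y = one"

definition pbck_commutative :: "'a set \<Rightarrow> ('a \<Rightarrow> 'a \<Rightarrow> 'a) \<Rightarrow> ('a \<Rightarrow> 'a \<Rightarrow> 'a) \<Rightarrow> bool"
  where "pbck_commutative A imp wimp \<longleftrightarrow>
    (\<forall>x\<in>A. \<forall>y\<in>A.
        wimp (imp x y) y = wimp (imp y x) x \<and>
        imp (wimp x y) y = imp (wimp y x) x)"

lemma (in pseudo_bck_algebra) pbck_le_iff_wimp:
  assumes "x \<in> A" "y \<in> A"
  shows "pbck_le imp \<one> x y \<longleftrightarrow> x \<leadsto> y = \<one>"
proof -
  have "x \<leadsto> ((x \<rightarrow> y) \<leadsto> y) = \<one>"
    using imp_trans[of "\<one>" x y] assms by (simp add: one_closed one_imp)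
  moreover have "x \<rightarrow> ((x \<leadsto> y) \<rightarrow> y) = \<one>"
    using wimp_trans[of "\<one>" x y] assms by (simp add: one_closed one_wimp)
  ultimately show ?thesis
    using assms by (metis pbck_le_def one_imp one_wimp)
qed

end

theory Submission
  imports Defs
begin

text \<open>
  The axioms are symmetric in the two implications, and each of the four conditions is a
  conjunction of an identity and its mirror image. The equivalences already hold between the
  unmirrored halves. The main step is from (d) to (a): the element \<open>u = (x \<rightarrow> y) \<leadsto> y\<close> is an
  upper bound of \<open>x\<close> and \<open>y\<close>, so (d) gives \<open>u = (u \<rightarrow> x) \<leadsto> x\<close>, and antitonicity
  together with \<open>y \<le> u\<close> gives \<open>(y \<rightarrow> x) \<leadsto> x \<le> u\<close>. Exchanging \<open>x\<close> and \<open>y\<close> gives equality.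
\<close>

context pseudo_bck_algebra
begin

lemmas closed = imp_closed wimp_closed one_closed

lemma wimp_eq_one_iff: "\<lbrakk>x \<in> A; y \<in> A\<rbrakk> \<Longrightarrow> x \<leadsto> y = \<one> \<longleftrightarrow> x \<rightarrow> y = \<one>"
  using pbck_le_iff_wimp by (simp add: pbck_le_def)

text \<open>Every fact proved for one arrow thereby gives its mirror image. The axioms stated for
  \<rightarrow> alone, \<open>imp_one\<close> and \<open>imp_antisym\<close>, transfer because both
  arrows induce the same order.\<close>

lemma dual: "pseudo_bck_algebra A wimp imp \<one>"
proof
  show "x = y" if "x \<in> A" "y \<in> A" "x \<leadsto> y = \<one>" "y \<leadsto> x = \<one>" for x y
    using that imp_antisym[of x y] wimp_eq_one_iff by blast
qed (simp_all add: closed imp_trans wimp_trans one_imp one_wimp imp_one wimp_eq_one_iff)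

text \<open>This lemma and the next two are special cases of \<open>imp_trans\<close>: first
  argument \<open>\<one>\<close>, middle argument \<open>\<one>\<close>, and first factor equal to
  \<open>\<one>\<close>.\<close>

lemma le_imp_wimp: "\<lbrakk>x \<in> A; y \<in> A\<rbrakk> \<Longrightarrow> x \<rightarrow> ((x \<rightarrow> y) \<leadsto> y) = \<one>"
  using imp_trans[of \<one> x y] by (simp add: closed one_imp wimp_eq_one_iff)

lemma le_imp: "\<lbrakk>x \<in> A; y \<in> A\<rbrakk> \<Longrightarrow> x \<rightarrow> (y \<rightarrow> x) = \<one>"
  using imp_trans[of y \<one> x] by (simp add: closed one_imp one_wimp imp_one wimp_eq_one_iff)

lemma imp_antitone:
  "\<lbrakk>x \<in> A; y \<in> A; z \<in> A; x \<rightarrow> y = \<one>\<rbrakk> \<Longrightarrow> (y \<rightarrow> z) \<rightarrow> (x \<rightarrow> z) = \<one>"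
  using imp_trans[of x y z] by (simp add: closed one_wimp wimp_eq_one_iff)

lemma le_wimp: "\<lbrakk>x \<in> A; y \<in> A\<rbrakk> \<Longrightarrow> x \<rightarrow> (y \<leadsto> x) = \<one>"
  using pseudo_bck_algebra.le_imp[OF dual, of x y] by (simp add: closed wimp_eq_one_iff)

lemma le_wimp_imp: "\<lbrakk>x \<in> A; y \<in> A\<rbrakk> \<Longrightarrow> x \<rightarrow> ((x \<leadsto> y) \<rightarrow> y) = \<one>"
  using pseudo_bck_algebra.le_imp_wimp[OF dual, of x y] by (simp add: closed wimp_eq_one_iff)

lemma wimp_antitone:
  "\<lbrakk>x \<in> A; y \<in> A; z \<in> A; x \<rightarrow> y = \<one>\<rbrakk> \<Longrightarrow> (y \<leadsto> z) \<rightarrow> (x \<leadsto> z) = \<one>"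
  using pseudo_bck_algebra.imp_antitone[OF dual, of x y z] by (simp add: closed wimp_eq_one_iff)

text \<open>For fixed \<open>y\<close>, the antitone maps
  \<open>a \<mapsto> a \<rightarrow> y\<close> and \<open>a \<mapsto> a \<leadsto> y\<close> form a
  Galois connection, so three alternating applications collapse to one.\<close>

lemma imp_wimp_imp:
  assumes "x \<in> A" "y \<in> A"
  shows "((x \<rightarrow> y) \<leadsto> y) \<rightarrow> y = x \<rightarrow> y"
proof (rule imp_antisym)
  show "(((x \<rightarrow> y) \<leadsto> y) \<rightarrow> y) \<rightarrow> (x \<rightarrow> y) = \<one>"
    using assms by (simp add: imp_antitone le_imp_wimp closed)
qed (use assms in \<open>simp_all add: le_wimp_imp closed\<close>)

lemma imp_commute_iff_absorb:
  "(\<forall>x\<in>A. \<forall>y\<in>A. (x \<rightarrow> y) \<leadsto> y = (y \<rightarrow> x) \<leadsto> x) \<longleftrightarrow>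
   (\<forall>x\<in>A. \<forall>y\<in>A. x \<rightarrow> y = \<one> \<longrightarrow> y = (y \<rightarrow> x) \<leadsto> x)"
proof (intro iffI ballI impI)
  fix x y assume comm: "\<forall>x\<in>A. \<forall>y\<in>A. (x \<rightarrow> y) \<leadsto> y = (y \<rightarrow> x) \<leadsto> x"
    and xy: "x \<in> A" "y \<in> A" "x \<rightarrow> y = \<one>"
  have "y = (x \<rightarrow> y) \<leadsto> y" using xy(2,3) by (simp add: one_wimp)
  also have "\<dots> = (y \<rightarrow> x) \<leadsto> x" by (rule comm[rule_format, OF xy(1,2)])
  finally show "y = (y \<rightarrow> x) \<leadsto> x" .
next
  assume absorb: "\<forall>x\<in>A. \<forall>y\<in>A. x \<rightarrow> y = \<one> \<longrightarrow> y = (y \<rightarrow> x) \<leadsto> x"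
  have le: "((y \<rightarrow> x) \<leadsto> x) \<rightarrow> ((x \<rightarrow> y) \<leadsto> y) = \<one>" if xy: "x \<in> A" "y \<in> A" for x y
  proof -
    define u where "u = (x \<rightarrow> y) \<leadsto> y"
    have u: "u \<in> A" "x \<rightarrow> u = \<one>" "y \<rightarrow> u = \<one>"
      using xy by (simp_all add: u_def closed le_imp_wimp le_wimp)
    \<comment> \<open>The order is reversed twice: \<open>y \<le> u\<close> gives
      \<open>u \<rightarrow> x \<le> y \<rightarrow> x\<close>, and applying
      \<open>\<leadsto> x\<close> turns it round again.\<close>
    have "((y \<rightarrow> x) \<leadsto> x) \<rightarrow> ((u \<rightarrow> x) \<leadsto> x) = \<one>"
      using xy u by (simp add: wimp_antitone imp_antitone closed)
    moreover have "(u \<rightarrow> x) \<leadsto> x = u"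
      by (rule absorb[rule_format, OF xy(1) u(1,2), symmetric])
    ultimately show ?thesis by (simp add: u_def)
  qed
  show "(x \<rightarrow> y) \<leadsto> y = (y \<rightarrow> x) \<leadsto> x" if "x \<in> A" "y \<in> A" for x y
    using that by (intro imp_antisym[OF _ _ le le] closed)
qed

text \<open>Commuting the bracket on the right reduces the forward direction to
  \<open>imp_wimp_imp\<close>. The converse goes through (d): if \<open>x \<le> y\<close>, the left
  side is \<open>\<one>\<close>, so \<open>(y \<rightarrow> x) \<leadsto> x \<le> y\<close>; the
  reverse inequality always holds.\<close>

lemma imp_commute_iff_imp_eq:
  "(\<forall>x\<in>A. \<forall>y\<in>A. (x \<rightarrow> y) \<leadsto> y = (y \<rightarrow> x) \<leadsto> x) \<longleftrightarrow>
   (\<forall>x\<in>A. \<forall>y\<in>A. x \<rightarrow> y = ((y \<rightarrow> x) \<leadsto> x) \<rightarrow> y)"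
proof
  assume comm: "\<forall>x\<in>A. \<forall>y\<in>A. (x \<rightarrow> y) \<leadsto> y = (y \<rightarrow> x) \<leadsto> x"
  show "\<forall>x\<in>A. \<forall>y\<in>A. x \<rightarrow> y = ((y \<rightarrow> x) \<leadsto> x) \<rightarrow> y"
  proof (intro ballI)
    fix x y assume xy: "x \<in> A" "y \<in> A"
    show "x \<rightarrow> y = ((y \<rightarrow> x) \<leadsto> x) \<rightarrow> y"
      unfolding comm[rule_format, OF xy, symmetric] imp_wimp_imp[OF xy] ..
  qed
next
  assume eq: "\<forall>x\<in>A. \<forall>y\<in>A. x \<rightarrow> y = ((y \<rightarrow> x) \<leadsto> x) \<rightarrow> y"
  have "y = (y \<rightarrow> x) \<leadsto> x" if xy: "x \<in> A" "y \<in> A" "x \<rightarrow> y = \<one>" for x y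
  proof (rule imp_antisym)
    show "((y \<rightarrow> x) \<leadsto> x) \<rightarrow> y = \<one>"
      using eq[rule_format, OF xy(1,2), symmetric] xy(3) by (rule trans)
  qed (use xy in \<open>simp_all add: closed le_imp_wimp\<close>)
  then show "\<forall>x\<in>A. \<forall>y\<in>A. (x \<rightarrow> y) \<leadsto> y = (y \<rightarrow> x) \<leadsto> x"
    unfolding imp_commute_iff_absorb by (intro ballI impI)
qed

text \<open>For fixed \<open>x\<close>, the elements \<open>(x \<rightarrow> y) \<leadsto> y\<close>
  are exactly the upper bounds of \<open>x\<close>, since an upper bound \<open>y\<close> is its own
  value. Hence (c) is a reparametrised (d).\<close>

lemma imp_commute_iff_wimp_eq:
  "(\<forall>x\<in>A. \<forall>y\<in>A. (x \<rightarrow> y) \<leadsto> y = (y \<rightarrow> x) \<leadsto> x) \<longleftrightarrow>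
   (\<forall>x\<in>A. \<forall>y\<in>A. (x \<rightarrow> y) \<leadsto> y = (((x \<rightarrow> y) \<leadsto> y) \<rightarrow> x) \<leadsto> x)"
  unfolding imp_commute_iff_absorb
proof (intro iffI ballI impI)
  fix x y assume absorb: "\<forall>x\<in>A. \<forall>y\<in>A. x \<rightarrow> y = \<one> \<longrightarrow> y = (y \<rightarrow> x) \<leadsto> x"
    and xy: "x \<in> A" "y \<in> A"
  show "(x \<rightarrow> y) \<leadsto> y = (((x \<rightarrow> y) \<leadsto> y) \<rightarrow> x) \<leadsto> x"
    using xy by (intro absorb[rule_format] le_imp_wimp closed)
next
  fix x y assume eq: "\<forall>x\<in>A. \<forall>y\<in>A. (x \<rightarrow> y) \<leadsto> y = (((x \<rightarrow> y) \<leadsto> y) \<rightarrow> x) \<leadsto> x"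
    and xy: "x \<in> A" "y \<in> A" "x \<rightarrow> y = \<one>"
  have y: "(x \<rightarrow> y) \<leadsto> y = y" using xy(2,3) by (simp add: one_wimp)
  have "(x \<rightarrow> y) \<leadsto> y = (((x \<rightarrow> y) \<leadsto> y) \<rightarrow> x) \<leadsto> x" by (rule eq[rule_format, OF xy(1,2)])
  then show "y = (y \<rightarrow> x) \<leadsto> x" unfolding y .
qed

end

theorem theorem3p9:
  fixes A :: "'a set"
    and imp :: "'a \<Rightarrow> 'a \<Rightarrow> 'a" (infixr "\<rightarrow>" 70)
    and wimp :: "'a \<Rightarrow> 'a \<Rightarrow> 'a" (infixr "\<leadsto>" 70)
    and one :: 'a ("\<one>")
  assumes "pseudo_bck_algebra A imp wimp one"
  shows "(pbck_commutative A imp wimp \<longleftrightarrow>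
          (\<forall>x\<in>A. \<forall>y\<in>A.
            x \<rightarrow> y = ((y \<rightarrow> x) \<leadsto> x) \<rightarrow> y \<and>
            x \<leadsto> y = ((y \<leadsto> x) \<rightarrow> x) \<leadsto> y)) \<and>
         (pbck_commutative A imp wimp \<longleftrightarrow>
          (\<forall>x\<in>A. \<forall>y\<in>A.
            (x \<rightarrow> y) \<leadsto> y = (((x \<rightarrow> y) \<leadsto> y) \<rightarrow> x) \<leadsto> x \<and>
            (x \<leadsto> y) \<rightarrow> y = (((x \<leadsto> y) \<rightarrow> y) \<leadsto> x) \<rightarrow> x)) \<and>
         (pbck_commutative A imp wimp \<longleftrightarrow>
          (\<forall>x\<in>A. \<forall>y\<in>A. pbck_le imp \<one> x y \<longrightarrow>
            y = (y \<rightarrow> x) \<leadsto> x \<and>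
            (y \<rightarrow> x) \<leadsto> x = (y \<leadsto> x) \<rightarrow> x))"
proof -
  interpret pseudo_bck_algebra A imp wimp one by fact
  note dual_iffs =
    pseudo_bck_algebra.imp_commute_iff_imp_eq[OF dual]
    pseudo_bck_algebra.imp_commute_iff_wimp_eq[OF dual]
    pseudo_bck_algebra.imp_commute_iff_absorb[OF dual]
  have comm: "pbck_commutative A imp wimp \<longleftrightarrow>
      (\<forall>x\<in>A. \<forall>y\<in>A. (x \<rightarrow> y) \<leadsto> y = (y \<rightarrow> x) \<leadsto> x) \<and>
      (\<forall>x\<in>A. \<forall>y\<in>A. (x \<leadsto> y) \<rightarrow> y = (y \<leadsto> x) \<rightarrow> x)"
    unfolding pbck_commutative_def by blast
  \<comment> \<open>Condition (d) chains two equations, while the two halves each give an equation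
    for \<open>y\<close>.\<close>
  have split_eqs: "(P \<longrightarrow> a = b) \<and> (P \<longrightarrow> a = c) \<longleftrightarrow> (P \<longrightarrow> a = b \<and> b = c)"
    for P and a b c :: 'a
    by auto
  show ?thesis
  proof (intro conjI)
    show "pbck_commutative A imp wimp \<longleftrightarrow>
        (\<forall>x\<in>A. \<forall>y\<in>A. x \<rightarrow> y = ((y \<rightarrow> x) \<leadsto> x) \<rightarrow> y \<and>
          x \<leadsto> y = ((y \<leadsto> x) \<rightarrow> x) \<leadsto> y)"
      by (simp only: comm imp_commute_iff_imp_eq dual_iffs(1) ball_conj_distrib)
    show "pbck_commutative A imp wimp \<longleftrightarrow>
        (\<forall>x\<in>A. \<forall>y\<in>A. (x \<rightarrow> y) \<leadsto> y = (((x \<rightarrow> y) \<leadsto> y) \<rightarrow> x) \<leadsto> x \<and>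
          (x \<leadsto> y) \<rightarrow> y = (((x \<leadsto> y) \<rightarrow> y) \<leadsto> x) \<rightarrow> x)"
      by (simp only: comm imp_commute_iff_wimp_eq dual_iffs(2) ball_conj_distrib)
    show "pbck_commutative A imp wimp \<longleftrightarrow>
        (\<forall>x\<in>A. \<forall>y\<in>A. pbck_le imp \<one> x y \<longrightarrow>
          y = (y \<rightarrow> x) \<leadsto> x \<and> (y \<rightarrow> x) \<leadsto> x = (y \<leadsto> x) \<rightarrow> x)"
      unfolding comm imp_commute_iff_absorb dual_iffs(3) pbck_le_def ball_conj_distrib[symmetric]
      \<comment> \<open>The mirrored half has the premise \<open>x \<leadsto> y = \<one>\<close>.
        Rewriting it to \<open>x \<rightarrow> y = \<one>\<close> needs \<open>x\<close> and
        \<open>y\<close> in \<open>A\<close>, which \<open>ball_cong\<close> makes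
        available.\<close>
      by (intro ball_cong refl) (simp only: wimp_eq_one_iff split_eqs)
  qed
qed

end
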